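(* Let $0<\delta\le1$, $0<\epsilon<\tfrac18$, $\kappa>0$ and $N\ge2$, and let $q\in\mathbf{N}$ with $N\ge q^{\kappa}$. Then there is $c_0>0$ such that \[ \sum_{\substack{x<n\le x+y\\ n\equiv r\ (\mathrm{mod}\ q)}}\tau_N(n)\ll\frac{y\,\phi(q)\log N}{q^2} \] uniformly for $N$, $r\in\mathbf{Z}$ with $(r,q)=1$, and real $x,y$ with $x^{\frac{1+4\epsilon\delta}{1+\delta}}\le y\le x$ and $x\ge c_0q^{1+\delta}$, where $c_0$ and the implied constant depend at most on $\delta,\epsilon,\kappa$. In particular, under the same conditions, \[ \sum_{\substack{m\le x\\ m\equiv r\ (\mathrm{mod}\ q)}}\tau_N(m)\ll\frac{\phi(q)\,x\log N}{q^2}. \]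
   Context: $\tau_N(m)=\#\{d\in\mathbf{N}: d\le N,\ d\mid m\}$ for $m\in\mathbf{N}$; sums are over positive integers. $\phi$ is Euler's totient function. *)

theory Defs
  imports Complex_Main "HOL-Number_Theory.Number_Theory"
begin

definition tau_le :: "real \<Rightarrow> nat \<Rightarrow> nat" where
  "tau_le N m = card {d :: nat. d > 0 \<and> real d \<le> N \<and> d dvd m}"

end

theory Submission
  imports Defs "HOL-Library.FuncSet" "HOL-Library.Discrete_Functions" "HOL-Analysis.Harmonic_Numbers"
begin

text \<open>
  For \<open>d\<close> up to \<open>z = x powr (\<eta> / 2)\<close>, where \<open>z\<^sup>2 \<le> y / q\<close>, multiples of \<open>d\<close> in the progression can
  be counted directly, which settles \<open>N \<le> z\<close>: the sum \<open>\<Sum>d\<le>N. 1 / d\<close> over \<open>d\<close> coprime to \<open>q\<close> is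
  \<open>O(\<phi>(q) / q * ln N)\<close>, because multiplying it by the sum of \<open>1 / e\<close> over the divisors \<open>e\<close> of \<open>q\<close>
  gives at most \<open>\<Sum>n\<le>Nq. 1 / n\<close>.

  For \<open>N > z\<close> the full divisor function is compared with \<open>\<tau>\<^sub>z\<close>, following Erdos. Fix \<open>K\<close> such that
  \<open>n \<le> z powr K\<close>. Let \<open>a\<close> be the product of the smallest prime factors of \<open>n\<close>, taken as long as it
  stays at most \<open>z\<close>, let \<open>P\<close> be the next prime factor and \<open>b = n / a\<close>. Then \<open>\<tau>(n) \<le> \<tau>(a) \<tau>(b)\<close> with
  \<open>\<tau>(a) \<le> \<tau>\<^sub>z(n)\<close>, and \<open>\<tau>(b)\<close> is bounded unless \<open>P\<close> is much smaller than \<open>z\<close>. In that case \<open>a > z / P\<close>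
  is a large \<open>P\<close>-smooth divisor of \<open>n\<close>. Sorting \<open>P\<close> into the ranges from \<open>2 ^ 2 ^ i\<close> to
  \<open>2 ^ 2 ^ (i + 1)\<close>, a Rankin factor \<open>(a / sqrt z) powr \<beta>\<close> with \<open>\<beta> = min (1/4) (4 K / 2 ^ i)\<close>
  outweighs \<open>\<tau>(b)\<close> and leaves a saving that is summable over \<open>i\<close>.
\<close>

section \<open>Multiplicative functions\<close>

definition multiplicative :: "(nat \<Rightarrow> 'a :: comm_semiring_1) \<Rightarrow> bool" where
  "multiplicative f \<longleftrightarrow> f 1 = 1 \<and> (\<forall>a>0. \<forall>b>0. coprime a b \<longrightarrow> f (a * b) = f a * f b)"

lemma multiplicative_mult:
  "multiplicative f \<Longrightarrow> multiplicative g \<Longrightarrow> multiplicative (\<lambda>n. f n * g n)"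
  by (auto simp: multiplicative_def mult_ac)

lemma multiplicative_of_nat:
  "multiplicative f \<Longrightarrow> multiplicative (\<lambda>n. of_nat (f n))"
  by (auto simp: multiplicative_def)

lemma multiplicative_powr: "multiplicative (\<lambda>n. real n powr \<beta>)"
  by (auto simp: multiplicative_def powr_mult)

lemma multiplicative_inverse_of_nat: "multiplicative (\<lambda>n. 1 / real n)"
  by (auto simp: multiplicative_def)

lemma multiplicative_totient: "multiplicative totient"
  by (auto simp: multiplicative_def totient_mult_coprime)

lemma multiplicative_apply_prod_prime_powers:
  assumes f: "multiplicative f" and "finite A" "\<And>p. p \<in> A \<Longrightarrow> prime p"
  shows "f (\<Prod>p\<in>A. p ^ e p) = (\<Prod>p\<in>A. f (p ^ e p))"
  using assms(2,3)
proof (induction A rule: finite_induct)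
  case empty
  then show ?case using f by (simp add: multiplicative_def)
next
  case (insert p A)
  have "coprime (p ^ e p) (\<Prod>p\<in>A. p ^ e p)"
    using insert by (intro prod_coprime_right) (auto intro: primes_coprime)
  moreover have "p ^ e p > 0" "(\<Prod>p\<in>A. p ^ e p) > 0"
    using insert by (auto intro!: prod_pos prime_gt_0_nat)
  ultimately show ?case using f insert by (simp add: multiplicative_def)
qed

lemma prod_prime_powers_multiplicity:
  fixes n :: nat
  assumes "finite A" "\<And>p. p \<in> A \<Longrightarrow> prime p" "n > 0" "prime_factors n \<subseteq> A"
  shows "(\<Prod>p\<in>A. p ^ multiplicity p n) = n"
proof -
  have "(\<Prod>p\<in>A. p ^ multiplicity p n) = (\<Prod>p\<in>prime_factors n. p ^ multiplicity p n)"
    using assms by (intro prod.mono_neutral_right) (auto simp: prime_factors_multiplicity)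
  with assms(3) show ?thesis by (simp add: prod_prime_factors)
qed

lemma multiplicative_eq_prod:
  assumes "multiplicative f" "finite A" "\<And>p. p \<in> A \<Longrightarrow> prime p" "n > 0" "prime_factors n \<subseteq> A"
  shows "f n = (\<Prod>p\<in>A. f (p ^ multiplicity p n))"
  using multiplicative_apply_prod_prime_powers[OF assms(1-3), of "\<lambda>p. multiplicity p n"]
  by (simp add: prod_prime_powers_multiplicity[OF assms(2-5)])

lemma multiplicative_eq_prod_prime_factors:
  assumes "multiplicative f" "n > 0"
  shows "f n = (\<Prod>p\<in>prime_factors n. f (p ^ multiplicity p n))"
  using assms by (intro multiplicative_eq_prod) auto

lemma multiplicative_eqI:
  assumes "multiplicative f" "multiplicative g" "\<And>p k. prime p \<Longrightarrow> f (p ^ k) = g (p ^ k)" "n > 0"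
  shows "f n = g n"
  unfolding multiplicative_eq_prod_prime_factors[OF assms(1,4)] multiplicative_eq_prod_prime_factors[OF assms(2,4)]
  using assms(3) by (intro prod.cong) auto

lemma bij_betw_divisors_mult_coprime:
  fixes a b :: nat
  assumes "coprime a b"
  shows "bij_betw (\<lambda>(d, e). d * e) ({d. d dvd a} \<times> {e. e dvd b}) {d. d dvd a * b}"
  unfolding bij_betw_def
proof
  have gcd_eq: "gcd (d * e) a = d" "gcd (d * e) b = e" if "d dvd a" "e dvd b" for d e
  proof -
    have "coprime a e" "coprime b d"
      using that assms by (meson coprime_commute coprime_divisors dvd_refl)+
    then show "gcd (d * e) a = d" "gcd (d * e) b = e"
      using that by (simp_all add: gcd_mult_left_right_cancel gcd_mult_left_left_cancel gcd_nat.absorb1)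
  qed
  show "inj_on (\<lambda>(d, e). d * e) ({d. d dvd a} \<times> {e. e dvd b})"
    by (rule inj_on_inverseI[of _ "\<lambda>n. (gcd n a, gcd n b)"]) (auto simp: gcd_eq)
  show "(\<lambda>(d, e). d * e) ` ({d. d dvd a} \<times> {e. e dvd b}) = {d. d dvd a * b}"
    by (auto intro: mult_dvd_mono elim!: dvd_productE)
qed

lemma multiplicative_sum_divisors:
  assumes f: "multiplicative f"
  shows "multiplicative (\<lambda>n. \<Sum>d | d dvd n. f d)"
  unfolding multiplicative_def
proof (intro conjI allI impI)
  fix a b :: nat
  assume pos: "a > 0" "b > 0" and cop: "coprime a b"
  have f_mult: "f (d * e) = f d * f e" if "d dvd a" "e dvd b" for d e
  proof -
    have "d > 0" "e > 0" "coprime d e"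
      using that pos cop by (auto intro: Nat.gr0I coprime_divisors)
    with f show ?thesis by (simp add: multiplicative_def)
  qed
  have "(\<Sum>d | d dvd a * b. f d) = (\<Sum>(d, e)\<in>{d. d dvd a} \<times> {e. e dvd b}. f (d * e))"
    by (subst sum.reindex_bij_betw[OF bij_betw_divisors_mult_coprime[OF cop], symmetric])
       (simp add: case_prod_unfold)
  also have "\<dots> = (\<Sum>(d, e)\<in>{d. d dvd a} \<times> {e. e dvd b}. f d * f e)"
    using f_mult by (intro sum.cong) auto
  also have "\<dots> = (\<Sum>d | d dvd a. f d) * (\<Sum>e | e dvd b. f e)"
    by (simp add: sum_product sum.cartesian_product)
  finally show "(\<Sum>d | d dvd a * b. f d) = (\<Sum>d | d dvd a. f d) * (\<Sum>e | e dvd b. f e)" .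
qed (use f in \<open>simp add: multiplicative_def\<close>)

lemma sum_divisors_prime_power:
  fixes p :: nat
  assumes "prime p"
  shows "(\<Sum>d | d dvd p ^ k. f d) = (\<Sum>i\<le>k. f (p ^ i))"
proof -
  have "{d. d dvd p ^ k} = (\<lambda>i. p ^ i) ` {..k}"
    using divides_primepow_nat[OF assms] by auto
  moreover have "inj_on (\<lambda>i. p ^ i) {..k}"
    using prime_gt_1_nat[OF assms] by (intro inj_onI) simp
  ultimately show ?thesis by (simp add: sum.reindex)
qed

lemma multiplicity_le_self:
  fixes p n :: nat
  assumes "prime p" "n > 0"
  shows "multiplicity p n \<le> n"
proof -
  have "multiplicity p n < p ^ multiplicity p n"
    using prime_gt_1_nat[OF assms(1)] by (simp add: power_gt_expt)
  also have "\<dots> \<le> n"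
    using assms(2) by (intro dvd_imp_le multiplicity_dvd)
  finally show ?thesis by simp
qed

lemma sum_multiplicative_le_euler_prod:
  fixes f :: "nat \<Rightarrow> real"
  assumes f: "multiplicative f" "\<And>n. f n \<ge> 0"
    and A: "finite A" "\<And>p. p \<in> A \<Longrightarrow> prime p"
    and S: "S \<subseteq> {0<..L}" "\<And>n. n \<in> S \<Longrightarrow> prime_factors n \<subseteq> A"
  shows "(\<Sum>n\<in>S. f n) \<le> (\<Prod>p\<in>A. \<Sum>k\<le>L. f (p ^ k))"
proof -
  define exponents where "exponents n = restrict (\<lambda>p. multiplicity p n) A" for n :: nat
  have n_eq: "(\<Prod>p\<in>A. p ^ exponents n p) = n" if "n \<in> S" for n
    using prod_prime_powers_multiplicity[OF A, of n] S that by (auto simp: exponents_def)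
  have "inj_on exponents S"
    by (rule inj_on_inverseI[of _ "\<lambda>e. \<Prod>p\<in>A. p ^ e p"]) (rule n_eq)
  moreover have "f n = (\<Prod>p\<in>A. f (p ^ exponents n p))" if "n \<in> S" for n
    using multiplicative_eq_prod[OF f(1) A, of n] S that by (auto simp: exponents_def)
  ultimately have "(\<Sum>n\<in>S. f n) = (\<Sum>e\<in>exponents ` S. \<Prod>p\<in>A. f (p ^ e p))"
    by (simp add: sum.reindex)
  also have "\<dots> \<le> (\<Sum>e\<in>A \<rightarrow>\<^sub>E {..L}. \<Prod>p\<in>A. f (p ^ e p))"
  proof (rule sum_mono2)
    show "finite (A \<rightarrow>\<^sub>E {..L})" using A by (intro finite_PiE) auto
    have "multiplicity p n \<le> L" if "p \<in> A" "n \<in> S" for p n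
      using multiplicity_le_self[of p n] A(2)[OF that(1)] subsetD[OF S(1) that(2)] by simp
    then show "exponents ` S \<subseteq> A \<rightarrow>\<^sub>E {..L}"
      by (auto simp: exponents_def)
  qed (use f in \<open>auto intro: prod_nonneg\<close>)
  also have "\<dots> = (\<Prod>p\<in>A. \<Sum>k\<le>L. f (p ^ k))"
    using A by (intro prod_sum_PiE[symmetric]) auto
  finally show ?thesis .
qed

section \<open>The divisor function\<close>

definition divisor_count :: "nat \<Rightarrow> nat" where
  "divisor_count n = card {d. d dvd n}"

lemma divisor_count_1 [simp]: "divisor_count (Suc 0) = 1"
  by (simp add: divisor_count_def)

lemma multiplicative_divisor_count: "multiplicative divisor_count"
proof -
  have "multiplicative (\<lambda>n. \<Sum>d | d dvd n. 1 :: nat)"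
    by (rule multiplicative_sum_divisors) (simp add: multiplicative_def)
  then show ?thesis by (simp add: divisor_count_def[abs_def])
qed

lemma divisor_count_prime_power: "prime p \<Longrightarrow> divisor_count (p ^ k) = k + 1"
  using sum_divisors_prime_power[of p "\<lambda>_. 1 :: nat" k] by (simp add: divisor_count_def)

lemma divisor_count_mult_le:
  assumes "m > 0" "n > 0"
  shows "divisor_count (m * n) \<le> divisor_count m * divisor_count n"
proof -
  have "{d. d dvd m * n} \<subseteq> (\<lambda>(a, b). a * b) ` ({d. d dvd m} \<times> {d. d dvd n})"
    by (auto elim!: dvd_productE)
  then have "card {d. d dvd m * n} \<le> card ({d. d dvd m} \<times> {d. d dvd n})"
    using assms by (intro surj_card_le) auto
  then show ?thesis
    by (simp add: divisor_count_def card_cartesian_product)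
qed

lemma divisor_count_le_prod_powr:
  assumes n: "n > 0"
    and local_bound: "\<And>p k. p \<in> prime_factors n \<Longrightarrow> real k + 1 \<le> c p * real (p ^ k) powr \<theta>"
  shows "real (divisor_count n) \<le> (\<Prod>p\<in>prime_factors n. c p) * real n powr \<theta>"
proof -
  have "real (divisor_count n) = (\<Prod>p\<in>prime_factors n. real (divisor_count (p ^ multiplicity p n)))"
    using multiplicative_of_nat[OF multiplicative_divisor_count] n
    by (rule multiplicative_eq_prod_prime_factors)
  also have "\<dots> = (\<Prod>p\<in>prime_factors n. real (multiplicity p n) + 1)"
    by (intro prod.cong) (auto simp: divisor_count_prime_power in_prime_factors_imp_prime add.commute)
  also have "\<dots> \<le> (\<Prod>p\<in>prime_factors n. c p * real (p ^ multiplicity p n) powr \<theta>)"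
    using local_bound by (intro prod_mono) auto
  also have "\<dots> = (\<Prod>p\<in>prime_factors n. c p) * real n powr \<theta>"
    using multiplicative_eq_prod_prime_factors[OF multiplicative_powr n] by (simp add: prod.distrib)
  finally show ?thesis .
qed

lemma of_nat_power_powr: "real (p ^ k) powr \<theta> = (real p powr \<theta>) ^ k"
  by (induction k) (simp_all add: powr_mult)

lemma Suc_le_prime_power_powr:
  assumes "\<theta> > 0" "2 powr (1 / \<theta>) \<le> real p"
  shows "real k + 1 \<le> real (p ^ k) powr \<theta>"
proof -
  have "Suc k \<le> 2 ^ k" by (simp add: Suc_leI less_exp)
  then have "real (Suc k) \<le> real (2 ^ k)" by (subst of_nat_le_iff)
  also have "\<dots> = ((2 powr (1 / \<theta>)) powr \<theta>) ^ k" using assms by (simp add: powr_powr)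
  also have "\<dots> \<le> (real p powr \<theta>) ^ k"
    using assms by (intro power_mono powr_mono2) auto
  finally show ?thesis by (simp add: of_nat_power_powr del: of_nat_power)
qed

lemma divisor_count_rough_le:
  assumes "n > 0" "\<theta> > 0" "\<And>p. p \<in> prime_factors n \<Longrightarrow> 2 powr (1 / \<theta>) \<le> real p"
  shows "real (divisor_count n) \<le> real n powr \<theta>"
  using divisor_count_le_prod_powr[of n "\<lambda>_. 1" \<theta>] Suc_le_prime_power_powr assms by simp

lemma Suc_le_mult_power_powr:
  assumes "0 < \<theta>" "\<theta> \<le> 1" "p \<ge> 2"
  shows "real k + 1 \<le> 2 / \<theta> * real (p ^ k) powr \<theta>"
proof -
  have "\<theta> * (real k + 1) / 2 \<le> 1 + real k * \<theta> * (1 / 2)"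
    using assms by (simp add: field_simps)
  also have "\<dots> \<le> 1 + real k * \<theta> * ln 2"
    using ln2_ge_two_thirds assms by (intro add_left_mono mult_left_mono) auto
  also have "\<dots> \<le> exp (real k * \<theta> * ln 2)"
    by (rule exp_ge_add_one_self)
  also have "\<dots> = real (2 ^ k) powr \<theta>"
    by (simp add: powr_def ln_realpow mult_ac)
  also have "\<dots> \<le> real (p ^ k) powr \<theta>"
    using assms by (intro powr_mono2 of_nat_mono power_mono) auto
  finally show ?thesis using assms(1) by (simp add: field_simps)
qed

definition divisor_bound_const :: "real \<Rightarrow> real" where
  "divisor_bound_const \<theta> = (2 / \<theta>) ^ nat \<lceil>2 powr (1 / \<theta>)\<rceil>"

lemma divisor_bound_const_ge_1: "0 < \<theta> \<Longrightarrow> \<theta> \<le> 1 \<Longrightarrow> divisor_bound_const \<theta> \<ge> 1"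
  unfolding divisor_bound_const_def by (intro one_le_power) (simp add: field_simps)

lemma divisor_count_le_powr:
  assumes \<theta>: "0 < \<theta>" "\<theta> \<le> 1" and n: "n > 0"
  shows "real (divisor_count n) \<le> divisor_bound_const \<theta> * real n powr \<theta>"
proof -
  define W where "W = nat \<lceil>2 powr (1 / \<theta>)\<rceil>"
  define c where "c p = (if p \<in> {..<W} then 2 / \<theta> else 1)" for p
  have "real (divisor_count n) \<le> (\<Prod>p\<in>prime_factors n. c p) * real n powr \<theta>"
  proof (rule divisor_count_le_prod_powr[OF n])
    fix p k assume "p \<in> prime_factors n"
    then have p_ge_2: "p \<ge> 2" by (auto intro: prime_ge_2_nat)
    show "real k + 1 \<le> c p * real (p ^ k) powr \<theta>"
    proof (cases "p < W")
      case True
      then show ?thesis using Suc_le_mult_power_powr[OF \<theta> p_ge_2] by (simp add: c_def)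
    next
      case False
      then have "2 powr (1 / \<theta>) \<le> real p" unfolding W_def by linarith
      then show ?thesis using Suc_le_prime_power_powr \<theta> False by (simp add: c_def)
    qed
  qed
  also have "(\<Prod>p\<in>prime_factors n. c p) = (2 / \<theta>) ^ card (prime_factors n \<inter> {..<W})"
    unfolding c_def by (subst prod.inter_restrict[symmetric]) simp_all
  also have "\<dots> \<le> divisor_bound_const \<theta>"
    unfolding divisor_bound_const_def W_def[symmetric]
    using \<theta> card_mono[of "{..<W}" "prime_factors n \<inter> {..<W}"]
    by (intro power_increasing) (auto simp: field_simps)
  finally show ?thesis by (simp add: mult_right_mono)
qed

lemma finite_nat_real_le: "finite {n :: nat. n > 0 \<and> real n \<le> x \<and> P n}"
  by (rule finite_subset[of _ "{..nat \<lfloor>x\<rfloor>}"]) (auto simp: le_nat_floor)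

lemma tau_le_le_divisor_count: "n > 0 \<Longrightarrow> tau_le N n \<le> divisor_count n"
  unfolding tau_le_def divisor_count_def by (intro card_mono) auto

lemma divisor_count_mult_le_tau_le:
  assumes "a > 0" "b > 0" "real a \<le> z"
  shows "divisor_count (a * b) \<le> tau_le z (a * b) * divisor_count b"
proof -
  have "d > 0 \<and> real d \<le> z \<and> d dvd a * b" if "d dvd a" for d
    using that assms dvd_imp_le[of d a] by (auto intro: Nat.gr0I)
  then have "divisor_count a \<le> tau_le z (a * b)"
    unfolding divisor_count_def tau_le_def by (intro card_mono finite_nat_real_le) auto
  then show ?thesis
    using divisor_count_mult_le[OF assms(1,2)] by (meson le_trans mult_le_mono1)
qed

section \<open>Integers coprime to the modulus\<close>

lemma prod_one_minus_inverse_square_ge: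
  assumes "finite P" "\<And>p :: nat. p \<in> P \<Longrightarrow> p \<ge> 2"
  shows "(\<Prod>p\<in>P. 1 - 1 / (real p)\<^sup>2) \<ge> 1 / 2"
proof -
  have telescope: "(\<Prod>k=2..Suc m. 1 - 1 / (real k)\<^sup>2) = (real m + 2) / (2 * (real m + 1))" for m
  proof (induction m)
    case (Suc m)
    have "(\<Prod>k=2..Suc (Suc m). 1 - 1 / (real k)\<^sup>2) =
        (real m + 2) / (2 * (real m + 1)) * (1 - 1 / (real m + 2)\<^sup>2)"
      using Suc by (simp add: prod.nat_ivl_Suc' algebra_simps)
    also have "\<dots> = (real (Suc m) + 2) / (2 * (real (Suc m) + 1))"
      by (simp add: divide_simps power2_eq_square) (simp add: algebra_simps)
    finally show ?case .
  qed simp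
  have factor_bounds: "0 \<le> 1 - 1 / (real p)\<^sup>2" "1 - 1 / (real p)\<^sup>2 \<le> 1" if "p \<ge> 2" for p :: nat
    using that by (auto simp: field_simps)
  obtain m where P_subset: "P \<subseteq> {2..Suc m}"
  proof
    show "P \<subseteq> {2..Suc (Max P)}"
      using assms by (auto intro!: le_SucI Max_ge)
  qed
  have "1 / 2 \<le> (\<Prod>k=2..Suc m. 1 - 1 / (real k)\<^sup>2)"
    unfolding telescope by (simp add: field_simps)
  also have "\<dots> = (\<Prod>k\<in>{2..Suc m} - P. 1 - 1 / (real k)\<^sup>2) * (\<Prod>k\<in>P. 1 - 1 / (real k)\<^sup>2)"
    by (rule prod.subset_diff) (use P_subset in auto)
  also have "\<dots> \<le> 1 * (\<Prod>k\<in>P. 1 - 1 / (real k)\<^sup>2)"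
    by (intro mult_right_mono prod_le_1 prod_nonneg conjI factor_bounds) (use assms(2) in auto)
  finally show ?thesis by simp
qed

lemma totient_mult_sum_inverse_divisors_ge:
  assumes "q > 0"
  shows "1 / 2 \<le> real (totient q) / real q * (\<Sum>e | e dvd q. 1 / real e)"
proof -
  define F where "F n = real (totient n) * (1 / real n) * (\<Sum>e | e dvd n. 1 / real e)" for n
  have mult_F: "multiplicative F"
    unfolding F_def
    by (intro multiplicative_mult multiplicative_of_nat multiplicative_totient
        multiplicative_sum_divisors multiplicative_inverse_of_nat)
  have local_bound: "1 - 1 / (real p)\<^sup>2 \<le> F (p ^ k)" if p: "prime p" and k: "k > 0" for p k
  proof -
    have p_pos: "real p > 0" using prime_gt_0_nat[OF p] by simp
    obtain j where k_eq: "k = Suc j" using k by (cases k) auto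
    have "1 - 1 / (real p)\<^sup>2 = (1 - 1 / real p) * (\<Sum>i\<le>1. 1 / real (p ^ i))"
      using p_pos by (simp add: field_simps power2_eq_square)
    also have "\<dots> \<le> (1 - 1 / real p) * (\<Sum>i\<le>k. 1 / real (p ^ i))"
      using p_pos k prime_ge_1_nat[OF p] by (intro mult_left_mono sum_mono2) auto
    also have "1 - 1 / real p = real (totient (p ^ k)) * (1 / real (p ^ k))"
      unfolding k_eq totient_prime_power_Suc[OF p] using p_pos prime_ge_1_nat[OF p]
      by (simp add: of_nat_diff field_simps)
    finally show ?thesis by (simp add: F_def sum_divisors_prime_power[OF p])
  qed
  have "1 / 2 \<le> (\<Prod>p\<in>prime_factors q. 1 - 1 / (real p)\<^sup>2)"
    by (rule prod_one_minus_inverse_square_ge) (auto dest: in_prime_factors_imp_prime prime_ge_2_nat)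
  also have "\<dots> \<le> (\<Prod>p\<in>prime_factors q. F (p ^ multiplicity p q))"
  proof (intro prod_mono conjI)
    fix p assume "p \<in> prime_factors q"
    then have "prime p" "multiplicity p q > 0" by (auto simp: prime_factors_multiplicity)
    then show "1 - 1 / (real p)\<^sup>2 \<le> F (p ^ multiplicity p q)" by (rule local_bound)
    show "0 \<le> 1 - 1 / (real p)\<^sup>2"
      using prime_ge_1_nat[OF \<open>prime p\<close>] by (simp add: field_simps)
  qed
  also have "\<dots> = F q"
    using mult_F assms by (rule multiplicative_eq_prod_prime_factors[symmetric])
  finally show ?thesis by (simp add: F_def)
qed

definition coprime_upto :: "nat \<Rightarrow> real \<Rightarrow> nat set" where
  "coprime_upto q z = {d. d > 0 \<and> real d \<le> z \<and> coprime d q}"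

definition coprime_harmonic :: "nat \<Rightarrow> real \<Rightarrow> real" where
  "coprime_harmonic q z = (\<Sum>d\<in>coprime_upto q z. 1 / real d)"

lemma finite_coprime_upto: "finite (coprime_upto q z)"
  unfolding coprime_upto_def by (rule finite_nat_real_le)

lemma coprime_harmonic_nonneg: "coprime_harmonic q z \<ge> 0"
  unfolding coprime_harmonic_def by (intro sum_nonneg) simp

lemma harm_le_ln:
  assumes "m > 0"
  shows "harm m \<le> 1 + ln (real m)"
  using decseqD[OF decseq_harm_diff_ln, of 0 "m - 1"] assms by (simp add: harm_expand)

lemma inj_on_mult_coprime_divisor:
  assumes q: "q > 0"
  shows "inj_on (\<lambda>(d, e). d * e) (coprime_upto q z \<times> {e. e dvd q})"
proof (rule inj_on_inverseI)
  \<comment> \<open>The divisor \<open>e\<close> is recovered from the product as \<open>gcd (d * e) q\<close>.\<close>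
  have gcd_eq: "gcd (d * e) q = e" if "coprime d q" "e dvd q" for d e
    using that by (simp add: gcd_mult_left_left_cancel coprime_commute gcd_nat.absorb1)
  fix x assume "x \<in> coprime_upto q z \<times> {e. e dvd q}"
  then show "(\<lambda>n. (n div gcd n q, gcd n q)) ((\<lambda>(d, e). d * e) x) = x"
    using q by (auto simp: coprime_upto_def gcd_eq dvd_pos_nat)
qed

lemma coprime_harmonic_mult_sum_inverse_divisors_le:
  assumes q: "q > 0" and z: "z \<ge> 1"
  shows "coprime_harmonic q z * (\<Sum>e | e dvd q. 1 / real e) \<le> 1 + ln (z * real q)"
proof -
  define m where "m = nat \<lfloor>z * real q\<rfloor>"
  let ?mult = "\<lambda>(d, e). d * e" and ?P = "coprime_upto q z \<times> {e. e dvd q}"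
  have "1 * 1 \<le> z * real q" using q z by (intro mult_mono) auto
  then have m_bounds: "m > 0" "real m \<le> z * real q" by (auto simp: m_def)
  have "coprime_harmonic q z * (\<Sum>e | e dvd q. 1 / real e) = (\<Sum>x\<in>?P. 1 / real (?mult x))"
    by (simp add: coprime_harmonic_def sum_product sum.cartesian_product case_prod_unfold)
  also have "\<dots> = (\<Sum>n\<in>?mult ` ?P. 1 / real n)"
    using sum.reindex[OF inj_on_mult_coprime_divisor[OF q], of "\<lambda>n. 1 / real n"] by simp
  also have "\<dots> \<le> (\<Sum>n=1..m. 1 / real n)"
  proof (rule sum_mono2)
    show "?mult ` ?P \<subseteq> {1..m}"
    proof clarify
      fix d e assume "d \<in> coprime_upto q z" and e: "e dvd q"
      then have "0 < d" "0 < e" and "real d \<le> z"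
        using q by (auto simp: coprime_upto_def dvd_pos_nat)
      moreover have "e \<le> q" using e q by (rule dvd_imp_le)
      ultimately have "real (d * e) \<le> z * real q"
        unfolding of_nat_mult by (intro mult_mono) auto
      then show "d * e \<in> {1..m}"
        using \<open>0 < d\<close> \<open>0 < e\<close> by (simp add: m_def le_nat_floor Suc_le_eq)
    qed
  qed auto
  also have "\<dots> = harm m" by (simp add: harm_def inverse_eq_divide)
  also have "\<dots> \<le> 1 + ln (real m)" using m_bounds(1) by (rule harm_le_ln)
  also have "\<dots> \<le> 1 + ln (z * real q)" using m_bounds by (intro add_left_mono ln_mono) auto
  finally show ?thesis .
qed

lemma coprime_harmonic_le:
  assumes q: "q > 0" and z: "z \<ge> 1"
  shows "coprime_harmonic q z \<le> 2 * (real (totient q) / real q) * (1 + ln (z * real q))"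
proof -
  let ?\<sigma> = "\<Sum>e | e dvd q. 1 / real e"
  have "coprime_harmonic q z * (1 / 2) \<le> coprime_harmonic q z * (real (totient q) / real q * ?\<sigma>)"
    using totient_mult_sum_inverse_divisors_ge[OF q] coprime_harmonic_nonneg by (rule mult_left_mono)
  also have "\<dots> = real (totient q) / real q * (coprime_harmonic q z * ?\<sigma>)"
    by (simp only: mult_ac)
  also have "\<dots> \<le> real (totient q) / real q * (1 + ln (z * real q))"
    using coprime_harmonic_mult_sum_inverse_divisors_le[OF q z] by (rule mult_left_mono) simp
  finally show ?thesis by (simp add: mult_ac)
qed

lemma sum_inverse_lcm_le:
  assumes u: "u > 0"
  shows "(\<Sum>d\<in>coprime_upto q z. 1 / real (lcm u d))
           \<le> coprime_harmonic q z * (real (divisor_count u) / real u)"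
proof -
  let ?D = "coprime_upto q z" and ?split = "\<lambda>d. (gcd u d, d div gcd u d)"
  have inj: "inj_on ?split ?D"
    by (rule inj_on_inverseI[of _ "\<lambda>(e, k). e * k"]) simp
  have lcm_eq: "lcm u d = u * (d div gcd u d)" for d
    by (simp add: lcm_nat_def div_mult_swap)
  have "(\<Sum>d\<in>?D. 1 / real (lcm u d)) = (\<Sum>(e, k)\<in>?split ` ?D. 1 / real (u * k))"
    by (simp add: sum.reindex[OF inj] lcm_eq)
  also have "\<dots> \<le> (\<Sum>(e, k)\<in>{e. e dvd u} \<times> ?D. 1 / real (u * k))"
  proof (rule sum_mono2)
    show "?split ` ?D \<subseteq> {e. e dvd u} \<times> ?D"
    proof (intro image_subsetI SigmaI)
      fix d assume "d \<in> ?D"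
      then have d_props: "d > 0" "real d \<le> z" "coprime d q" by (auto simp: coprime_upto_def)
      have quot_dvd: "d div gcd u d dvd d" by (metis dvd_triv_left dvd_mult_div_cancel gcd_dvd2 mult.commute)
      then have "coprime (d div gcd u d) q" using d_props(3) by (meson coprime_divisors dvd_refl)
      moreover have "0 < d div gcd u d" using quot_dvd d_props(1) by (rule dvd_pos_nat[rotated])
      moreover have "real (d div gcd u d) \<le> z" using d_props(2) div_le_dividend[of d "gcd u d"] by linarith
      ultimately show "d div gcd u d \<in> ?D" by (simp add: coprime_upto_def)
    qed simp
  qed (use u finite_coprime_upto in auto)
  also have "\<dots> = coprime_harmonic q z * (real (divisor_count u) / real u)"
    by (simp add: sum.cartesian_product[symmetric] coprime_harmonic_def divisor_count_def
        sum_divide_distrib[symmetric] mult.commute[of "real u"] flip: divide_divide_eq_left)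
  finally show ?thesis .
qed

section \<open>Arithmetic progressions\<close>

definition progression :: "nat \<Rightarrow> int \<Rightarrow> real \<Rightarrow> real \<Rightarrow> nat set" where
  "progression q r w v = {n. n > 0 \<and> w < real n \<and> real n \<le> v \<and> [int n = r] (mod int q)}"

lemma finite_progression: "finite (progression q r w v)"
  by (rule finite_subset[OF _ finite_nat_real_le[of v "\<lambda>_. True"]]) (auto simp: progression_def)

lemma coprime_progression:
  assumes "coprime r (int q)" "n \<in> progression q r w v"
  shows "coprime n q"
proof -
  have "[r = int n] (mod int q)" using assms(2) by (simp add: progression_def cong_sym)
  then have "coprime (int n) (int q)" using assms(1) by (rule cong_imp_coprime)
  then show ?thesis by simp
qed

lemma card_cong_interval_le:
  fixes w y :: real and S :: "nat set"
  assumes m: "m > 0" and y: "y \<ge> 0"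
    and S: "\<And>n. n \<in> S \<Longrightarrow> w < real n \<and> real n \<le> w + y"
    and cong: "\<And>n n'. n \<in> S \<Longrightarrow> n' \<in> S \<Longrightarrow> [n = n'] (mod m)"
  shows "real (card S) \<le> y / real m + 1"
proof (cases "S = {}")
  case False
  have finite_S: "finite S"
    by (rule finite_subset[of _ "{..nat \<lfloor>w + y\<rfloor>}"]) (use S in \<open>auto simp: le_nat_floor\<close>)
  define a b where "a = Min S" and "b = Max S"
  have extremes: "a \<in> S" "b \<in> S" "\<And>n. n \<in> S \<Longrightarrow> a \<le> n \<and> n \<le> b"
    using finite_S False by (auto simp: a_def b_def)
  have "inj_on (\<lambda>n. n div m) S"
    by (intro inj_onI) (metis cong cong_def div_mult_mod_eq)
  moreover have "(\<lambda>n. n div m) ` S \<subseteq> {a div m..b div m}"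
    using extremes(3) by (auto intro!: div_le_mono)
  ultimately have "card S \<le> card {a div m..b div m}"
    by (intro card_inj_on_le) auto
  moreover have "a div m \<le> b div m" using extremes by (auto intro!: div_le_mono)
  ultimately have "real (card S) \<le> real (b div m) - real (a div m) + 1" by simp
  also have "real (b div m) - real (a div m) = (real b - real a) / real m"
  proof -
    have "real n = real (n div m) * real m + real (n mod m)" for n
      by (metis div_mult_mod_eq of_nat_add of_nat_mult)
    from this[of a] this[of b] show ?thesis
      using cong[OF extremes(1,2)] m by (simp add: cong_def field_simps)
  qed
  also have "\<dots> \<le> y / real m"
    using S[OF extremes(1)] S[OF extremes(2)] by (intro divide_right_mono) auto
  finally show ?thesis by simp
qed (use y in simp)

lemma card_progression_multiples_le:
  fixes w y :: real
  assumes "q > 0" "l > 0" "y \<ge> 0" and r: "coprime r (int q)"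
  shows "real (card {n \<in> progression q r w (w + y). l dvd n}) \<le> y / real (q * l) + 1"
proof (cases "coprime q l")
  case True
  show ?thesis
  proof (rule card_cong_interval_le[where w = w])
    fix n n' assume n: "n \<in> {n \<in> progression q r w (w + y). l dvd n}"
      and n': "n' \<in> {n \<in> progression q r w (w + y). l dvd n}"
    have "[int n = int n'] (mod int q)"
      using n n' by (auto simp: progression_def intro: cong_trans cong_sym)
    then have "[n = n'] (mod q)" by (simp add: cong_int_iff)
    moreover have "[n = n'] (mod l)" using n n' by (simp add: cong_def)
    ultimately show "[n = n'] (mod (q * l))" using True by (simp add: coprime_cong_mult_nat)
  qed (use assms in \<open>auto simp: progression_def\<close>)
next
  case False
  have "\<not> l dvd n" if "n \<in> progression q r w (w + y)" for n
    using coprime_progression[OF r that] False by (metis coprime_commute coprime_divisors dvd_refl)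
  then have "{n \<in> progression q r w (w + y). l dvd n} = {}" by blast
  then show ?thesis using assms by (simp only: card.empty) simp
qed

section \<open>Chebyshev and Mertens bounds for primes\<close>

lemma prod_primes_dvd:
  fixes n :: nat
  assumes "finite A" "\<And>p. p \<in> A \<Longrightarrow> prime p" "\<And>p. p \<in> A \<Longrightarrow> p dvd n"
  shows "\<Prod>A dvd n"
  using assms
proof (induction A rule: finite_induct)
  case (insert p A)
  have "coprime p (\<Prod>A)"
    using insert by (intro prod_coprime_right) (auto intro!: primes_coprime)
  then show ?case using insert by (simp add: divides_mult)
qed auto

lemma prod_primes_dyadic_le: "\<Prod>{p :: nat. prime p \<and> n < p \<and> p \<le> 2 * n} \<le> 4 ^ n"
proof -
  have "\<Prod>{p :: nat. prime p \<and> n < p \<and> p \<le> 2 * n} dvd (2 * n choose n)"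
  proof (rule prod_primes_dvd)
    fix p assume "p \<in> {p :: nat. prime p \<and> n < p \<and> p \<le> 2 * n}"
    then have p: "prime p" "n < p" "p \<le> 2 * n" by auto
    have "p dvd fact (2 * n)" using p by (simp add: prime_dvd_fact_iff)
    also have "(fact (2 * n) :: nat) = fact n * fact n * (2 * n choose n)"
      using binomial_fact_lemma[of n "2 * n"] by (simp add: mult_2)
    finally show "p dvd (2 * n choose n)"
      using p by (auto simp: prime_dvd_mult_iff prime_dvd_fact_iff)
  qed auto
  then have "\<Prod>{p :: nat. prime p \<and> n < p \<and> p \<le> 2 * n} \<le> (2 * n choose n)"
    by (rule dvd_imp_le) simp
  also have "\<dots> \<le> 2 ^ (2 * n)" by (rule binomial_le_pow2)
  finally show ?thesis by (simp add: power_mult)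
qed

lemma sum_ln_over_primes_dyadic_le:
  assumes "n > 0"
  shows "(\<Sum>p | prime p \<and> n < p \<and> p \<le> 2 * n. ln (real p) / real p) \<le> ln 4"
proof -
  let ?A = "{p :: nat. prime p \<and> n < p \<and> p \<le> 2 * n}"
  have pos: "real p > 0" if "p \<in> ?A" for p using that by (auto intro: prime_gt_0_nat)
  have "(\<Prod>p\<in>?A. real p) \<le> 4 ^ n"
    using of_nat_mono[OF prod_primes_dyadic_le[of n], where 'a = real] by simp
  then have "ln (\<Prod>p\<in>?A. real p) \<le> ln (4 ^ n)"
    using pos by (intro ln_mono prod_pos)
  moreover have "ln (\<Prod>p\<in>?A. real p) = (\<Sum>p\<in>?A. ln (real p))"
    using pos by (intro ln_prod) force+
  ultimately have "(\<Sum>p\<in>?A. ln (real p)) \<le> real n * ln 4"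
    by (simp add: ln_realpow)
  then have "(\<Sum>p\<in>?A. ln (real p) / real n) \<le> ln 4"
    using assms by (simp add: field_simps flip: sum_divide_distrib)
  moreover have "(\<Sum>p\<in>?A. ln (real p) / real p) \<le> (\<Sum>p\<in>?A. ln (real p) / real n)"
    using assms by (intro sum_mono divide_left_mono) auto
  ultimately show ?thesis by linarith
qed

lemma sum_ln_over_primes_le:
  "(\<Sum>p | prime p \<and> p \<le> 2 ^ k. ln (real p) / real p) \<le> real k * ln 4"
proof (induction k)
  case 0
  have "{p :: nat. prime p \<and> p \<le> 2 ^ 0} = {}"
    by (auto dest: prime_ge_2_nat)
  then show ?case by (simp only: sum.empty)
next
  case (Suc k)
  let ?A = "{p :: nat. prime p \<and> p \<le> 2 ^ k}" and ?B = "{p. prime p \<and> 2 ^ k < p \<and> p \<le> 2 * 2 ^ k}"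
  have "p \<le> 2 * 2 ^ k" if "p \<le> 2 ^ k" for p :: nat using that by linarith
  then have range_split: "{p :: nat. prime p \<and> p \<le> 2 ^ Suc k} = ?A \<union> ?B"
    by (auto simp: not_le)
  have "(\<Sum>p | prime p \<and> p \<le> 2 ^ Suc k. ln (real p) / real p)
      = (\<Sum>p\<in>?A. ln (real p) / real p) + (\<Sum>p\<in>?B. ln (real p) / real p)"
    unfolding range_split by (intro sum.union_disjoint) auto
  also have "\<dots> \<le> real k * ln 4 + ln 4"
    using Suc sum_ln_over_primes_dyadic_le[of "2 ^ k"] by (intro add_mono) auto
  finally show ?case by (simp add: algebra_simps)
qed

section \<open>Jordan totients of real order\<close>

text \<open>In Rankin's trick, \<open>a powr \<beta>\<close> is expanded into the divisor sum of the Jordan totient instead of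
  being summed directly. This keeps the loss bounded: the Euler product for the Jordan totient involves
  \<open>\<Sum>p\<le>w. \<beta> ln p / p\<close>, which is \<open>O(1)\<close> for \<open>\<beta> = O(1 / ln w)\<close>, instead of \<open>\<Sum>p\<le>w. 1 / p\<close>.\<close>

definition jordan_totient :: "real \<Rightarrow> nat \<Rightarrow> real" where
  "jordan_totient \<beta> n = real n powr \<beta> * (\<Prod>p\<in>prime_factors n. 1 - real p powr - \<beta>)"

lemma multiplicative_prod_over_prime_factors:
  "multiplicative (\<lambda>n. \<Prod>p\<in>prime_factors n. g p)"
  unfolding multiplicative_def
proof (intro conjI allI impI)
  fix a b :: nat
  assume "a > 0" "b > 0" "coprime a b"
  moreover have "prime_factors a \<inter> prime_factors b = {}"
  proof (rule ccontr)
    assume "prime_factors a \<inter> prime_factors b \<noteq> {}"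
    then obtain p where "prime p" "p dvd a" "p dvd b" by auto
    with \<open>coprime a b\<close> show False by (metis coprime_common_divisor not_prime_unit)
  qed
  ultimately show "(\<Prod>p\<in>prime_factors (a * b). g p) = (\<Prod>p\<in>prime_factors a. g p) * (\<Prod>p\<in>prime_factors b. g p)"
    by (simp add: prime_factors_product prod.union_disjoint)
qed simp

lemma multiplicative_jordan_totient: "multiplicative (jordan_totient \<beta>)"
  unfolding jordan_totient_def[abs_def]
  by (intro multiplicative_mult multiplicative_powr multiplicative_prod_over_prime_factors)

lemma jordan_totient_nonneg:
  assumes "\<beta> \<ge> 0"
  shows "jordan_totient \<beta> n \<ge> 0"
proof -
  have "real p powr - \<beta> \<le> 1" if "p \<in> prime_factors n" for p
  proof -
    have "p > 0" using that by (auto intro: prime_gt_0_nat)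
    then show ?thesis using assms powr_mono[of "- \<beta>" 0 "real p"] by simp
  qed
  then show ?thesis
    unfolding jordan_totient_def by (intro mult_nonneg_nonneg prod_nonneg) auto
qed

lemma jordan_totient_prime_power_Suc:
  assumes "prime p"
  shows "jordan_totient \<beta> (p ^ Suc k) = (real p powr \<beta>) ^ Suc k * (1 - real p powr - \<beta>)"
proof -
  have "prime_factors (p ^ Suc k) = {p}"
    using assms by (simp add: prime_factors_power prime_prime_factors del: power_Suc)
  then show ?thesis by (simp only: jordan_totient_def of_nat_power_powr) simp
qed

lemma sum_jordan_totient_divisors:
  assumes "n > 0"
  shows "(\<Sum>d | d dvd n. jordan_totient \<beta> d) = real n powr \<beta>"
proof (rule multiplicative_eqI[OF _ multiplicative_powr _ assms])
  fix p k :: nat assume p: "prime p"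
  then have "real p > 0" using prime_gt_0_nat by simp
  then have jordan_eq_diff: "jordan_totient \<beta> (p ^ Suc i) = real (p ^ Suc i) powr \<beta> - real (p ^ i) powr \<beta>" for i
    unfolding jordan_totient_prime_power_Suc[OF p] of_nat_power_powr
    by (simp add: powr_minus field_simps)
  have "(\<Sum>i\<le>k. jordan_totient \<beta> (p ^ i)) = real (p ^ k) powr \<beta>"
  proof (induction k)
    case (Suc k)
    then show ?case by (simp add: jordan_eq_diff del: power_Suc)
  qed (simp add: jordan_totient_def)
  then show "(\<Sum>d | d dvd p ^ k. jordan_totient \<beta> d) = real (p ^ k) powr \<beta>"
    by (simp only: sum_divisors_prime_power[OF p])
qed (intro multiplicative_sum_divisors multiplicative_jordan_totient)

lemma sum_linear_geometric_le:
  fixes x :: real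
  assumes "0 \<le> x" "x < 1"
  shows "(\<Sum>k<n. (real k + 1) * x ^ k) \<le> 1 / (1 - x)\<^sup>2"
proof -
  have "(\<lambda>k. (real k + 1) * x ^ k) sums (1 / (1 - x)\<^sup>2)"
    using geometric_deriv_sums[of x] assms by (simp add: add.commute)
  then show ?thesis
    using assms by (intro sum_le_suminf[of _ "{..<n}", THEN order_trans])
      (auto simp: sums_iff)
qed

definition jordan_divisor_ratio :: "real \<Rightarrow> nat \<Rightarrow> real" where
  "jordan_divisor_ratio \<beta> n = jordan_totient \<beta> n * (real (divisor_count n) / real n)"

lemma multiplicative_jordan_divisor_ratio: "multiplicative (jordan_divisor_ratio \<beta>)"
proof -
  have "multiplicative (\<lambda>n. jordan_totient \<beta> n * (real (divisor_count n) * (1 / real n)))"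
    by (intro multiplicative_mult multiplicative_of_nat multiplicative_jordan_totient
        multiplicative_divisor_count multiplicative_inverse_of_nat)
  then show ?thesis by (simp add: jordan_divisor_ratio_def[abs_def])
qed

lemma jordan_divisor_ratio_nonneg: "\<beta> \<ge> 0 \<Longrightarrow> jordan_divisor_ratio \<beta> n \<ge> 0"
  unfolding jordan_divisor_ratio_def by (simp add: jordan_totient_nonneg)

lemma jordan_divisor_ratio_prime_power_Suc_le:
  assumes p: "prime p" and \<beta>: "0 \<le> \<beta>" "\<beta> \<le> 1/2"
  shows "jordan_divisor_ratio \<beta> (p ^ Suc j)
           \<le> 2 * \<beta> * real p powr \<beta> * (ln (real p) / real p) * ((real j + 1) * (3/4) ^ j)"
proof -
  have p_ge_2: "real p \<ge> 2" using prime_ge_2_nat[OF p] by simp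
  define s where "s = real p powr \<beta>"
  have s_nonneg: "s \<ge> 0" by (simp add: s_def)
  have ratio_le: "s / real p \<le> 3 / 4"
  proof (rule power2_le_imp_le)
    have "s \<le> sqrt (real p)"
      unfolding s_def powr_half_sqrt[symmetric, OF of_nat_0_le_iff] using p_ge_2 \<beta> by (intro powr_mono) auto
    then have "s\<^sup>2 \<le> real p" using s_nonneg by (metis real_sqrt_le_iff real_sqrt_unique)
    then have "(s / real p)\<^sup>2 \<le> 1 / real p"
      using p_ge_2 by (simp add: power_divide power2_eq_square field_simps)
    also have "\<dots> \<le> 1 / 2" using p_ge_2 by (simp add: field_simps)
    also have "\<dots> \<le> (3 / 4)\<^sup>2" by (simp add: power2_eq_square)
    finally show "(s / real p)\<^sup>2 \<le> (3 / 4)\<^sup>2" .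
  qed simp
  have "1 - real p powr - \<beta> \<le> \<beta> * ln (real p)"
    using exp_ge_add_one_self[of "- (\<beta> * ln (real p))"] p_ge_2 by (simp add: powr_def)
  then have "jordan_totient \<beta> (p ^ Suc j) \<le> s ^ Suc j * (\<beta> * ln (real p))"
    unfolding jordan_totient_prime_power_Suc[OF p] s_def[symmetric] using s_nonneg by (intro mult_left_mono) auto
  then have "jordan_divisor_ratio \<beta> (p ^ Suc j)
      \<le> s ^ Suc j * (\<beta> * ln (real p)) * (real (divisor_count (p ^ Suc j)) / real (p ^ Suc j))"
    unfolding jordan_divisor_ratio_def by (rule mult_right_mono) simp
  also have "\<dots> = \<beta> * s * (ln (real p) / real p) * ((real j + 2) * (s / real p) ^ j)"
    unfolding divisor_count_prime_power[OF p] by (simp add: power_divide field_simps)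
  also have "\<dots> \<le> \<beta> * s * (ln (real p) / real p) * ((2 * (real j + 1)) * (3/4) ^ j)"
    using ratio_le s_nonneg p_ge_2 \<beta> by (intro mult_left_mono mult_mono power_mono mult_nonneg_nonneg) auto
  finally show ?thesis by (simp add: s_def algebra_simps)
qed

lemma jordan_euler_factor_le:
  assumes p: "prime p" and \<beta>: "0 \<le> \<beta>" "\<beta> \<le> 1/2"
  shows "(\<Sum>k\<le>L. jordan_divisor_ratio \<beta> (p ^ k))
           \<le> 1 + 32 * \<beta> * real p powr \<beta> * (ln (real p) / real p)"
proof -
  let ?c = "2 * \<beta> * real p powr \<beta> * (ln (real p) / real p)"
  have coeff_nonneg: "?c \<ge> 0" using prime_ge_1_nat[OF p] \<beta> by simp
  have "(\<Sum>k\<le>L. jordan_divisor_ratio \<beta> (p ^ k))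
      = 1 + (\<Sum>j<L. jordan_divisor_ratio \<beta> (p ^ Suc j))"
    by (subst sum.atMost_shift) (simp add: jordan_divisor_ratio_def jordan_totient_def)
  also have "(\<Sum>j<L. jordan_divisor_ratio \<beta> (p ^ Suc j)) \<le> (\<Sum>j<L. ?c * ((real j + 1) * (3/4) ^ j))"
    using jordan_divisor_ratio_prime_power_Suc_le[OF p \<beta>] by (rule sum_mono)
  also have "\<dots> = ?c * (\<Sum>j<L. (real j + 1) * (3/4) ^ j)"
    by (simp add: sum_distrib_left)
  also have "\<dots> \<le> ?c * (1 / (1 - 3/4)\<^sup>2)"
    using coeff_nonneg by (intro mult_left_mono sum_linear_geometric_le) auto
  finally show ?thesis by (simp add: power2_eq_square)
qed

definition smooth_upto :: "nat \<Rightarrow> real \<Rightarrow> nat set" where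
  "smooth_upto w z = {n. n > 0 \<and> real n \<le> z \<and> (\<forall>p\<in>prime_factors n. p \<le> w)}"

lemma finite_smooth_upto: "finite (smooth_upto w z)"
  unfolding smooth_upto_def by (rule finite_nat_real_le)

definition rankin_const :: "real \<Rightarrow> real" where
  "rankin_const B = exp (32 * 2 powr B * B * ln 4)"

lemma sum_jordan_divisor_ratio_smooth_le:
  assumes \<beta>: "0 \<le> \<beta>" "\<beta> \<le> 1/2" and B: "\<beta> * real M \<le> B"
  shows "(\<Sum>u\<in>smooth_upto (2 ^ M) z. jordan_divisor_ratio \<beta> u) \<le> rankin_const B"
proof -
  let ?A = "{p :: nat. prime p \<and> p \<le> 2 ^ M}" and ?c = "32 * \<beta> * 2 powr B"
  have "(\<Sum>u\<in>smooth_upto (2 ^ M) z. jordan_divisor_ratio \<beta> u)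
      \<le> (\<Prod>p\<in>?A. \<Sum>k\<le>nat \<lfloor>z\<rfloor>. jordan_divisor_ratio \<beta> (p ^ k))"
    using \<beta> by (intro sum_multiplicative_le_euler_prod multiplicative_jordan_divisor_ratio jordan_divisor_ratio_nonneg)
      (auto simp: smooth_upto_def le_nat_floor)
  also have "\<dots> \<le> (\<Prod>p\<in>?A. exp (?c * (ln (real p) / real p)))"
  proof (intro prod_mono conjI)
    fix p assume "p \<in> ?A"
    then have p: "prime p" "p \<le> 2 ^ M" by auto
    have "real p \<le> 2 powr real M"
      using of_nat_mono[OF p(2), where 'a = real] by (simp add: powr_realpow)
    then have "real p powr \<beta> \<le> (2 powr real M) powr \<beta>"
      using \<beta> by (intro powr_mono2) auto
    also have "\<dots> \<le> 2 powr B" using B by (simp add: powr_powr mult.commute)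
    finally have "real p powr \<beta> \<le> 2 powr B" .
    then have "32 * \<beta> * real p powr \<beta> * (ln (real p) / real p) \<le> ?c * (ln (real p) / real p)"
      using prime_ge_1_nat[OF p(1)] \<beta> by (intro mult_right_mono mult_left_mono) auto
    then show "(\<Sum>k\<le>nat \<lfloor>z\<rfloor>. jordan_divisor_ratio \<beta> (p ^ k)) \<le> exp (?c * (ln (real p) / real p))"
      using jordan_euler_factor_le[OF p(1) \<beta>, of "nat \<lfloor>z\<rfloor>"]
        exp_ge_add_one_self[of "?c * (ln (real p) / real p)"] by linarith
  qed (use \<beta> in \<open>auto intro: sum_nonneg jordan_divisor_ratio_nonneg\<close>)
  also have "\<dots> = exp (?c * (\<Sum>p\<in>?A. ln (real p) / real p))"
    by (simp add: exp_sum sum_distrib_left)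
  also have "\<dots> \<le> exp (?c * (real M * ln 4))"
    using sum_ln_over_primes_le[of M] \<beta> by (auto intro!: mult_left_mono)
  also have "?c * (real M * ln 4) = 32 * 2 powr B * (\<beta> * real M) * ln 4" by simp
  also have "exp \<dots> \<le> rankin_const B"
    unfolding rankin_const_def using B by (auto intro!: mult_left_mono mult_right_mono)
  finally show ?thesis .
qed

definition smooth_majorant :: "real \<Rightarrow> nat \<Rightarrow> real \<Rightarrow> nat \<Rightarrow> real" where
  "smooth_majorant \<beta> w z n = (\<Sum>u | u \<in> smooth_upto w z \<and> u dvd n. jordan_totient \<beta> u)"

lemma smooth_majorant_nonneg: "\<beta> \<ge> 0 \<Longrightarrow> smooth_majorant \<beta> w z n \<ge> 0"
  unfolding smooth_majorant_def by (intro sum_nonneg jordan_totient_nonneg)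

lemma powr_le_smooth_majorant:
  assumes "\<beta> \<ge> 0" "a \<in> smooth_upto w z" "a dvd n"
  shows "real a powr \<beta> \<le> smooth_majorant \<beta> w z n"
proof -
  have a_smooth: "a > 0" "real a \<le> z" "\<And>p. p \<in> prime_factors a \<Longrightarrow> p \<le> w"
    using assms(2) by (auto simp: smooth_upto_def)
  have "real a powr \<beta> = (\<Sum>u | u dvd a. jordan_totient \<beta> u)"
    using a_smooth(1) by (rule sum_jordan_totient_divisors[symmetric])
  also have "\<dots> \<le> smooth_majorant \<beta> w z n"
    unfolding smooth_majorant_def
  proof (rule sum_mono2)
    show "finite {u. u \<in> smooth_upto w z \<and> u dvd n}"
      using finite_smooth_upto by simp
    show "{u. u dvd a} \<subseteq> {u. u \<in> smooth_upto w z \<and> u dvd n}"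
    proof clarify
      fix u assume u: "u dvd a"
      then have "u > 0" "u \<le> a" "prime_factors u \<subseteq> prime_factors a"
        using a_smooth(1) by (auto intro: dvd_pos_nat dvd_imp_le dvd_prime_factors[THEN subsetD])
      then show "u \<in> smooth_upto w z \<and> u dvd n"
        using a_smooth u assms(3) by (auto simp: smooth_upto_def intro: dvd_trans)
    qed
  qed (use assms in \<open>simp add: jordan_totient_nonneg\<close>)
  finally show ?thesis .
qed

section \<open>Bounding the divisor function by its truncation\<close>

lemma smooth_rough_split:
  fixes z :: real
  assumes "1 \<le> z" "z < real n"
  shows "\<exists>a P b. n = a * b \<and> real a \<le> z \<and> z < real a * real P \<and> P \<in> prime_factors b \<and>
    (\<forall>p\<in>prime_factors a. p \<le> P) \<and> (\<forall>p\<in>prime_factors b. P \<le> p)"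
  using assms(2)
proof (induction n rule: less_induct)
  case (less n)
  then have n_gt_1: "n > 1" using assms(1) by linarith
  define p where "p = Max (prime_factors n)"
  have "prime_factors n \<noteq> {}"
    using n_gt_1 by (simp add: prime_factorization_empty_iff)
  then have p: "p \<in> prime_factors n" and p_max: "\<And>p'. p' \<in> prime_factors n \<Longrightarrow> p' \<le> p"
    by (auto simp: p_def)
  obtain m where m: "n = m * p"
    using in_prime_factors_imp_dvd[OF p] by (metis dvd_div_mult_self)
  have prime_p: "prime p" using p by (rule in_prime_factors_imp_prime)
  have pos: "m > 0" "p > 1" using n_gt_1 m prime_gt_1_nat[OF prime_p] by (auto intro: Nat.gr0I)
  show ?case
  proof (cases "real m \<le> z")
    case True
    moreover have "\<forall>p'\<in>prime_factors m. p' \<le> p"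
      using p_max pos by (auto simp: m prime_factors_product)
    ultimately show ?thesis
      using less.prems m prime_p by (intro exI[of _ m] exI[of _ p]) (auto simp: prime_prime_factors)
  next
    case False
    then obtain a P b where m_split: "m = a * b" "real a \<le> z" "z < real a * real P" "P \<in> prime_factors b"
      "\<forall>p\<in>prime_factors a. p \<le> P" "\<forall>p\<in>prime_factors b. P \<le> p"
      using less.IH[of m] pos by (auto simp: m)
    have "P \<le> p" using m_split(1,4) pos p_max by (auto simp: m prime_factors_product)
    then show ?thesis
      using m_split m prime_p pos by (intro exI[of _ a] exI[of _ P] exI[of _ "b * p"])
        (auto simp: prime_factors_product prime_prime_factors)
  qed
qed

lemma double_exponential_scale:
  fixes P :: nat
  assumes "P \<ge> 2"
  obtains i where "2 ^ (2 ^ i) \<le> P" "P < 2 ^ (2 ^ Suc i)"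
proof
  define j where "j = floor_log P"
  have "j > 0" using assms floor_log_rec[of P] by (simp add: j_def)
  have "(2 :: nat) ^ (2 ^ floor_log j) \<le> 2 ^ j"
    using \<open>j > 0\<close> by (intro power_increasing floor_log_exp2_le) auto
  also have "\<dots> \<le> P" unfolding j_def using assms by (intro floor_log_exp2_le) auto
  finally show "2 ^ (2 ^ floor_log j) \<le> P" .
  have "P < 2 ^ Suc j" unfolding j_def using floor_log_exp2_gt[of P] by simp
  also have "\<dots> \<le> 2 ^ (2 ^ Suc (floor_log j))"
    using floor_log_exp2_gt[of j] by (intro power_increasing) auto
  finally show "P < 2 ^ (2 ^ Suc (floor_log j))" .
qed

definition rankin_exponent :: "real \<Rightarrow> nat \<Rightarrow> real" where
  "rankin_exponent K i = min (1 / 4) (4 * K / 2 ^ i)"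

lemma rankin_exponent_pos: "K \<ge> 1 \<Longrightarrow> rankin_exponent K i > 0"
  by (simp add: rankin_exponent_def)

lemma divisor_count_rough_le_powr_rankin_exponent:
  assumes K: "K \<ge> 1" and b: "b > 0" "real b \<le> z powr K"
    and rough: "\<And>p. p \<in> prime_factors b \<Longrightarrow> 2 ^ (2 ^ i) \<le> p"
  shows "real (divisor_count b) \<le> divisor_bound_const (1 / (16 * K)) * z powr (rankin_exponent K i / 4)"
proof -
  let ?\<xi> = "1 / (16 * K)" and ?\<theta> = "min (1 / (16 * K)) (1 / 2 ^ i)"
  have const_ge_1: "divisor_bound_const ?\<xi> \<ge> 1" using K by (intro divisor_bound_const_ge_1) auto
  have "real (divisor_count b) \<le> divisor_bound_const ?\<xi> * real b powr ?\<theta>"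
  proof (cases "?\<xi> \<le> 1 / 2 ^ i")
    case True
    then show ?thesis using divisor_count_le_powr[of ?\<xi> b] K b by (simp add: min_absorb1)
  next
    case False
    have "2 powr (1 / (1 / 2 ^ i)) \<le> real p" if "p \<in> prime_factors b" for p
      using of_nat_mono[OF rough[OF that], where 'a = real] by (simp flip: powr_realpow)
    then have "real (divisor_count b) \<le> real b powr (1 / 2 ^ i)"
      using b by (intro divisor_count_rough_le) auto
    also have "\<dots> \<le> divisor_bound_const ?\<xi> * real b powr (1 / 2 ^ i)"
      using const_ge_1 mult_right_mono[of 1 "divisor_bound_const ?\<xi>" "real b powr (1 / 2 ^ i)"] by simp
    finally show ?thesis using False by (simp add: min_def)
  qed
  also have "\<dots> \<le> divisor_bound_const ?\<xi> * (z powr K) powr ?\<theta>"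
    using b const_ge_1 K by (intro mult_left_mono powr_mono2) auto
  also have "(z powr K) powr ?\<theta> = z powr (rankin_exponent K i / 4)"
    using K by (auto simp: powr_powr rankin_exponent_def min_def field_simps)
  finally show ?thesis .
qed

lemma powr_rankin_exponent_le_const:
  assumes K: "K \<ge> 1" and z: "z \<ge> 1" and sqrt_z_le: "sqrt z \<le> 2 ^ (2 ^ Suc i)"
  shows "z powr (rankin_exponent K i / 4) \<le> 16 powr K"
proof -
  have "(sqrt z)\<^sup>2 \<le> (2 ^ (2 ^ Suc i))\<^sup>2" using sqrt_z_le z by (intro power_mono) auto
  also have "\<dots> = 2 powr (4 * 2 ^ i)"
    using powr_realpow[of 2 "4 * 2 ^ i"] by (simp add: mult.commute flip: power_mult)
  finally have "z \<le> 2 powr (4 * 2 ^ i)" using z by simp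
  then have "z powr (K / 2 ^ i) \<le> (2 powr (4 * 2 ^ i)) powr (K / 2 ^ i)"
    using K z by (intro powr_mono2) auto
  also have "\<dots> = 2 powr (4 * K)" by (simp add: powr_powr)
  also have "\<dots> = (2 powr 4) powr K" by (simp only: powr_powr)
  also have "\<dots> = 16 powr K" by simp
  finally have "z powr (K / 2 ^ i) \<le> 16 powr K" .
  moreover have "z powr (rankin_exponent K i / 4) \<le> z powr (K / 2 ^ i)"
    using z by (intro powr_mono) (auto simp: rankin_exponent_def min_def mult.commute)
  ultimately show ?thesis by linarith
qed

lemma powr_le_rankin_shift:
  assumes "\<beta> \<ge> 0" "z > 0" "z < a * P" "P \<le> sqrt z" "a \<ge> 0"
  shows "z powr (\<beta> / 4) \<le> z powr (- (\<beta> / 4)) * a powr \<beta>"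
proof -
  have "sqrt z * sqrt z < a * P" using assms by simp
  also have "\<dots> \<le> a * sqrt z" using assms by (intro mult_left_mono)
  finally have "sqrt z < a" by (rule mult_right_less_imp_less) (use assms in simp)
  then have "(sqrt z) powr \<beta> \<le> a powr \<beta>" using assms by (intro powr_mono2) auto
  then have "z powr (\<beta> / 2) \<le> a powr \<beta>"
    using assms by (simp add: powr_half_sqrt[symmetric] powr_powr)
  then have "z powr (- (\<beta> / 4)) * z powr (\<beta> / 2) \<le> z powr (- (\<beta> / 4)) * a powr \<beta>"
    by (intro mult_left_mono) auto
  then show ?thesis by (simp flip: powr_add)
qed

definition scales :: "real \<Rightarrow> nat set" where
  "scales z = {i. 2 ^ (2 ^ i) \<le> sqrt z}"

lemma two_power_le_ln_scales:
  assumes "i \<in> scales z" "z > 0"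
  shows "2 ^ i \<le> ln z"
proof -
  have "ln ((2 :: real) ^ (2 ^ i)) \<le> ln (sqrt z)"
    using assms by (intro ln_mono) (auto simp: scales_def)
  then have "2 ^ i * ln 2 \<le> ln z / 2" using assms by (simp add: ln_realpow ln_sqrt)
  moreover have "2 ^ i * (1 / 2) \<le> 2 ^ i * ln (2 :: real)"
    using ln2_ge_two_thirds by (intro mult_left_mono) auto
  ultimately show ?thesis by linarith
qed

lemma finite_scales:
  assumes "z > 0"
  shows "finite (scales z)"
proof (rule finite_subset)
  have "real i \<le> ln z" if "i \<in> scales z" for i
    using two_power_le_ln_scales[OF that assms] of_nat_less_two_power[of i, where 'a = real] by linarith
  then show "scales z \<subseteq> {..nat \<lfloor>ln z\<rfloor>}" by (auto intro: le_nat_floor)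
qed simp

definition scale_majorant :: "real \<Rightarrow> real \<Rightarrow> nat \<Rightarrow> nat \<Rightarrow> real" where
  "scale_majorant K z i n = z powr (- (rankin_exponent K i / 4)) *
     smooth_majorant (rankin_exponent K i) (2 ^ (2 ^ Suc i)) z n"

lemma scale_majorant_nonneg: "K \<ge> 1 \<Longrightarrow> scale_majorant K z i n \<ge> 0"
  unfolding scale_majorant_def
  by (intro mult_nonneg_nonneg smooth_majorant_nonneg) (auto intro: less_imp_le rankin_exponent_pos)

definition truncation_const :: "real \<Rightarrow> real" where
  "truncation_const K = divisor_bound_const (1 / (16 * K)) * 16 powr K"

lemma truncation_const_ge_1:
  assumes "K \<ge> 1"
  shows "truncation_const K \<ge> 1"
proof -
  have "1 * 1 \<le> truncation_const K"
    unfolding truncation_const_def using assms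
    by (intro mult_mono' divisor_bound_const_ge_1) (auto simp: ge_one_powr_ge_zero)
  then show ?thesis by simp
qed

lemma powr_rankin_exponent_le_sum_scale_majorant:
  assumes K: "K \<ge> 1" and z: "z \<ge> 1" and a: "a dvd n" "a > 0" "real a \<le> z" "\<forall>p\<in>prime_factors a. p \<le> P"
    and P: "z < real a * real P" "2 ^ (2 ^ i) \<le> P" "P < 2 ^ (2 ^ Suc i)"
  shows "z powr (rankin_exponent K i / 4) \<le> 16 powr K * (1 + (\<Sum>i\<in>scales z. scale_majorant K z i n))"
proof -
  let ?\<beta> = "rankin_exponent K i" and ?S = "\<Sum>i\<in>scales z. scale_majorant K z i n"
  have exponent_nonneg: "?\<beta> \<ge> 0" using rankin_exponent_pos[OF K, of i] by simp
  have const_ge_1: "16 powr K \<ge> 1" using K by (simp add: ge_one_powr_ge_zero)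
  have majorant_sum_nonneg: "?S \<ge> 0" using K by (intro sum_nonneg scale_majorant_nonneg)
  show ?thesis
  proof (cases "real P \<le> sqrt z")
    case True
    have "real (2 ^ (2 ^ i)) \<le> real P" using P(2) by (simp only: of_nat_le_iff)
    also note True
    finally have "i \<in> scales z" by (simp add: scales_def)
    have "a \<in> smooth_upto (2 ^ (2 ^ Suc i)) z"
      using a P(3) by (auto simp: smooth_upto_def)
    then have "real a powr ?\<beta> \<le> smooth_majorant ?\<beta> (2 ^ (2 ^ Suc i)) z n"
      using a(1) exponent_nonneg by (intro powr_le_smooth_majorant)
    then have "z powr (- (?\<beta> / 4)) * real a powr ?\<beta> \<le> scale_majorant K z i n"
      unfolding scale_majorant_def by (rule mult_left_mono) simp
    with powr_le_rankin_shift[OF exponent_nonneg _ P(1) True] z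
    have "z powr (?\<beta> / 4) \<le> scale_majorant K z i n" by simp
    also have "\<dots> \<le> ?S"
      using \<open>i \<in> scales z\<close> finite_scales[of z] scale_majorant_nonneg[OF K] z by (intro member_le_sum) auto
    also have "\<dots> \<le> 1 * (1 + ?S)" by simp
    also have "\<dots> \<le> 16 powr K * (1 + ?S)" using const_ge_1 majorant_sum_nonneg by (intro mult_right_mono) auto
    finally show ?thesis .
  next
    case False
    have "real P \<le> 2 ^ (2 ^ Suc i)"
      using of_nat_mono[OF less_imp_le[OF P(3)], where 'a = real] by simp
    then have "z powr (?\<beta> / 4) \<le> 16 powr K"
      using False by (intro powr_rankin_exponent_le_const[OF K z]) linarith
    also have "\<dots> \<le> 16 powr K * (1 + ?S)" using majorant_sum_nonneg by (simp add: distrib_left)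
    finally show ?thesis .
  qed
qed

lemma exists_cofactor_divisor_count_le:
  assumes K: "K \<ge> 1" and z: "z \<ge> 1" and n: "n > 0" "real n \<le> z powr K"
  shows "\<exists>a b. n = a * b \<and> real a \<le> z \<and>
    real (divisor_count b) \<le> truncation_const K * (1 + (\<Sum>i\<in>scales z. scale_majorant K z i n))"
proof (cases "real n \<le> z")
  case True
  have "1 * 1 \<le> truncation_const K * (1 + (\<Sum>i\<in>scales z. scale_majorant K z i n))"
    using truncation_const_ge_1[OF K] scale_majorant_nonneg[OF K] by (intro mult_mono) (auto intro: sum_nonneg)
  with True show ?thesis by (intro exI[of _ n] exI[of _ 1]) simp
next
  case False
  let ?C = "divisor_bound_const (1 / (16 * K))"
  obtain a P b where ab: "n = a * b" "real a \<le> z" and P: "z < real a * real P" "P \<in> prime_factors b"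
    "\<forall>p\<in>prime_factors a. p \<le> P" "\<forall>p\<in>prime_factors b. P \<le> p"
    using smooth_rough_split[OF z, of n] False by auto
  have pos: "a > 0" "b > 0" using n ab by auto
  obtain i where i: "2 ^ (2 ^ i) \<le> P" "P < 2 ^ (2 ^ Suc i)"
    using double_exponential_scale[of P] P(2) by (auto intro: prime_ge_2_nat)
  have "b \<le> n" using ab(1) pos by simp
  then have "real b \<le> z powr K" using n(2) by linarith
  then have "real (divisor_count b) \<le> ?C * z powr (rankin_exponent K i / 4)"
    using P i pos by (intro divisor_count_rough_le_powr_rankin_exponent[OF K]) (auto intro: order_trans)
  also have "\<dots> \<le> ?C * (16 powr K * (1 + (\<Sum>i\<in>scales z. scale_majorant K z i n)))"
    using ab P i pos K divisor_bound_const_ge_1[of "1 / (16 * K)"]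
    by (intro mult_left_mono powr_rankin_exponent_le_sum_scale_majorant[OF K z]) auto
  finally show ?thesis using ab by (auto simp: truncation_const_def mult_ac)
qed

lemma divisor_count_le_tau_le_majorant:
  assumes "K \<ge> 1" "z \<ge> 1" and n: "n > 0" "real n \<le> z powr K"
  shows "real (divisor_count n)
    \<le> truncation_const K * (real (tau_le z n) * (1 + (\<Sum>i\<in>scales z. scale_majorant K z i n)))"
proof -
  let ?S = "\<Sum>i\<in>scales z. scale_majorant K z i n"
  obtain a b where ab: "n = a * b" "real a \<le> z" and b: "real (divisor_count b) \<le> truncation_const K * (1 + ?S)"
    using exists_cofactor_divisor_count_le[OF assms] by blast
  have "real (divisor_count n) \<le> real (tau_le z n) * real (divisor_count b)"
    using divisor_count_mult_le_tau_le[of a b z] n ab by (simp flip: of_nat_mult)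
  also have "\<dots> \<le> real (tau_le z n) * (truncation_const K * (1 + ?S))"
    using b by (rule mult_left_mono) simp
  finally show ?thesis by (simp add: mult_ac)
qed

lemma sum_powers_of_2_le:
  fixes M :: real
  assumes "finite I" "M \<ge> 0" "\<And>i. i \<in> I \<Longrightarrow> 2 ^ i \<le> M"
  shows "(\<Sum>i\<in>I. 2 ^ i :: real) \<le> 2 * M"
proof (cases "I = {}")
  case False
  have "(\<Sum>i\<in>I. 2 ^ i :: real) \<le> (\<Sum>i<Suc (Max I). 2 ^ i)"
    using assms by (intro sum_mono2) (auto simp: less_Suc_eq_le)
  also have "\<dots> = 2 * 2 ^ Max I - 1" by (subst geometric_sum) auto
  also have "\<dots> \<le> 2 * M" using assms(3)[OF Max_in[OF assms(1) False]] by linarith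
  finally show ?thesis .
qed (use assms in simp)

lemma sum_scales_powr_le:
  assumes K: "K \<ge> 1" and z: "z > 1"
  shows "(\<Sum>i\<in>scales z. z powr (- (rankin_exponent K i / 4))) \<le> 32"
proof -
  have ln_z_pos: "ln z > 0" using z by simp
  have "z powr (- (rankin_exponent K i / 4)) \<le> 16 / ln z * 2 ^ i" for i
  proof -
    define v where "v = ln z / (16 * 2 ^ i)"
    have v_pos: "v > 0" using ln_z_pos by (simp add: v_def)
    have v_le_exp: "v \<le> exp v" using exp_ge_add_one_self[of v] by linarith
    have "1 / (4 * 2 ^ i) \<le> rankin_exponent K i"
      using K by (auto simp: rankin_exponent_def field_simps)
    then have "z powr (- (rankin_exponent K i / 4)) \<le> z powr (- (1 / (4 * 2 ^ i) / 4))"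
      using z by (intro powr_mono) auto
    also have "\<dots> = 1 / exp v" using z by (simp add: powr_def v_def exp_minus inverse_eq_divide)
    also have "\<dots> \<le> 1 / v" using v_pos v_le_exp by (intro divide_left_mono) auto
    also have "\<dots> = 16 / ln z * 2 ^ i" by (simp add: v_def)
    finally show ?thesis .
  qed
  then have "(\<Sum>i\<in>scales z. z powr (- (rankin_exponent K i / 4))) \<le> 16 / ln z * (\<Sum>i\<in>scales z. 2 ^ i)"
    unfolding sum_distrib_left by (rule sum_mono)
  also have "\<dots> \<le> 16 / ln z * (2 * ln z)"
    using z ln_z_pos by (intro mult_left_mono sum_powers_of_2_le finite_scales two_power_le_ln_scales) auto
  finally show ?thesis using ln_z_pos by simp
qed

section \<open>Divisor sums over sets with a level of distribution\<close>

definition divisor_sum_const :: "real \<Rightarrow> real" where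
  "divisor_sum_const K = truncation_const K * (1 + 32 * rankin_const (8 * K))"

lemma divisor_sum_const_ge_1:
  assumes "K \<ge> 1"
  shows "divisor_sum_const K \<ge> 1"
proof -
  have "1 * 1 \<le> divisor_sum_const K"
    unfolding divisor_sum_const_def using truncation_const_ge_1[OF assms]
    by (intro mult_mono) (auto simp: rankin_const_def)
  then show ?thesis by simp
qed

locale level_of_distribution =
  fixes A :: "nat set" and q :: nat and Y z :: real
  assumes finite_A: "finite A"
    and pos_A: "\<And>n. n \<in> A \<Longrightarrow> n > 0"
    and coprime_A: "\<And>n. n \<in> A \<Longrightarrow> coprime n q"
    and Y_nonneg: "Y \<ge> 0"
    and z_ge_2: "z \<ge> 2"
    and card_multiples_le: "\<And>l. l > 0 \<Longrightarrow> real l \<le> z\<^sup>2 \<Longrightarrow> real (card {n \<in> A. l dvd n}) \<le> Y / real l"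
begin

lemma tau_le_eq_sum_coprime_upto:
  assumes "n \<in> A"
  shows "real (tau_le N n) = (\<Sum>d\<in>coprime_upto q N. if d dvd n then 1 else 0)"
proof -
  have "{d. d > 0 \<and> real d \<le> N \<and> d dvd n} = {d \<in> coprime_upto q N. d dvd n}"
    using coprime_A[OF assms] by (auto simp: coprime_upto_def intro: coprime_divisors[OF _ dvd_refl])
  then show ?thesis
    using finite_coprime_upto by (simp add: tau_le_def sum.inter_filter[symmetric])
qed

lemma sum_tau_le_multiples_le:
  assumes "N \<le> z" "u > 0" "real u \<le> z"
  shows "(\<Sum>n | n \<in> A \<and> u dvd n. real (tau_le N n))
           \<le> Y * coprime_harmonic q N * (real (divisor_count u) / real u)"
proof -
  have "(\<Sum>n | n \<in> A \<and> u dvd n. real (tau_le N n))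
      = (\<Sum>n | n \<in> A \<and> u dvd n. \<Sum>d\<in>coprime_upto q N. if d dvd n then 1 else 0)"
    by (intro sum.cong) (auto simp: tau_le_eq_sum_coprime_upto)
  also have "\<dots> = (\<Sum>d\<in>coprime_upto q N. \<Sum>n | n \<in> A \<and> u dvd n. if d dvd n then 1 else 0)"
    by (rule sum.swap)
  also have "\<dots> \<le> (\<Sum>d\<in>coprime_upto q N. Y * (1 / real (lcm u d)))"
  proof (rule sum_mono)
    fix d assume "d \<in> coprime_upto q N"
    then have d_bounds: "d > 0" "real d \<le> z" using assms by (auto simp: coprime_upto_def)
    have "(\<Sum>n | n \<in> A \<and> u dvd n. if d dvd n then 1 else 0) = real (card {n \<in> A. lcm u d dvd n})"
      using finite_A by (simp add: sum.inter_filter[symmetric])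
    also have "\<dots> \<le> Y / real (lcm u d)"
    proof (rule card_multiples_le)
      show "lcm u d > 0" using assms d_bounds by (simp add: lcm_pos_nat)
      have "lcm u d \<le> u * d" using assms d_bounds by (intro dvd_imp_le) auto
      then have "real (lcm u d) \<le> real u * real d" by (metis of_nat_le_iff of_nat_mult)
      also have "\<dots> \<le> z * z" using assms d_bounds by (intro mult_mono) auto
      finally show "real (lcm u d) \<le> z\<^sup>2" by (simp add: power2_eq_square)
    qed
    finally show "(\<Sum>n | n \<in> A \<and> u dvd n. if d dvd n then 1 else 0) \<le> Y * (1 / real (lcm u d))" by simp
  qed
  also have "\<dots> = Y * (\<Sum>d\<in>coprime_upto q N. 1 / real (lcm u d))"
    by (simp add: sum_distrib_left)
  also have "\<dots> \<le> Y * (coprime_harmonic q N * (real (divisor_count u) / real u))"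
    using sum_inverse_lcm_le[OF assms(2)] Y_nonneg by (rule mult_left_mono)
  finally show ?thesis by simp
qed

lemma sum_tau_le_short_le:
  assumes "N \<le> z"
  shows "(\<Sum>n\<in>A. real (tau_le N n)) \<le> Y * coprime_harmonic q N"
  using sum_tau_le_multiples_le[OF assms, of 1] z_ge_2 by simp

lemma sum_tau_le_smooth_majorant_le:
  assumes \<beta>: "0 \<le> \<beta>" "\<beta> \<le> 1 / 2" and B: "\<beta> * real M \<le> B"
  shows "(\<Sum>n\<in>A. real (tau_le z n) * smooth_majorant \<beta> (2 ^ M) z n)
           \<le> Y * coprime_harmonic q z * rankin_const B"
proof -
  let ?U = "smooth_upto (2 ^ M) z" and ?H = "coprime_harmonic q z"
  have majorant_eq: "smooth_majorant \<beta> (2 ^ M) z n = (\<Sum>u\<in>?U. if u dvd n then jordan_totient \<beta> u else 0)" for n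
    unfolding smooth_majorant_def using finite_smooth_upto by (simp add: sum.inter_filter)
  have "(\<Sum>n\<in>A. real (tau_le z n) * smooth_majorant \<beta> (2 ^ M) z n)
      = (\<Sum>u\<in>?U. \<Sum>n\<in>A. if u dvd n then real (tau_le z n) * jordan_totient \<beta> u else 0)"
    unfolding majorant_eq sum_distrib_left by (subst sum.swap) (intro sum.cong, auto)
  also have "\<dots> = (\<Sum>u\<in>?U. jordan_totient \<beta> u * (\<Sum>n | n \<in> A \<and> u dvd n. real (tau_le z n)))"
    unfolding sum.inter_filter[OF finite_A] sum_distrib_left by (intro sum.cong refl) auto
  also have "\<dots> \<le> (\<Sum>u\<in>?U. jordan_totient \<beta> u * (Y * ?H * (real (divisor_count u) / real u)))"
    using \<beta> by (intro sum_mono mult_left_mono sum_tau_le_multiples_le jordan_totient_nonneg)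
      (auto simp: smooth_upto_def)
  also have "\<dots> = Y * ?H * (\<Sum>u\<in>?U. jordan_divisor_ratio \<beta> u)"
    by (simp add: jordan_divisor_ratio_def sum_distrib_left mult_ac)
  also have "\<dots> \<le> Y * ?H * rankin_const B"
    using sum_jordan_divisor_ratio_smooth_le[OF \<beta> B] Y_nonneg coprime_harmonic_nonneg
    by (intro mult_left_mono) auto
  finally show ?thesis .
qed

lemma sum_tau_le_scale_majorant_le:
  assumes K: "K \<ge> 1"
  shows "(\<Sum>n\<in>A. real (tau_le z n) * scale_majorant K z i n)
           \<le> z powr (- (rankin_exponent K i / 4)) * (Y * coprime_harmonic q z * rankin_const (8 * K))"
proof -
  have "rankin_exponent K i * real (2 ^ Suc i) \<le> 4 * K / 2 ^ i * real (2 ^ Suc i)"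
    by (intro mult_right_mono) (auto simp: rankin_exponent_def)
  then have "(\<Sum>n\<in>A. real (tau_le z n) * smooth_majorant (rankin_exponent K i) (2 ^ (2 ^ Suc i)) z n)
      \<le> Y * coprime_harmonic q z * rankin_const (8 * K)"
    using rankin_exponent_pos[OF K, of i]
    by (intro sum_tau_le_smooth_majorant_le) (auto simp: rankin_exponent_def)
  then have "z powr (- (rankin_exponent K i / 4)) *
      (\<Sum>n\<in>A. real (tau_le z n) * smooth_majorant (rankin_exponent K i) (2 ^ (2 ^ Suc i)) z n)
      \<le> z powr (- (rankin_exponent K i / 4)) * (Y * coprime_harmonic q z * rankin_const (8 * K))"
    by (rule mult_left_mono) simp
  then show ?thesis by (simp add: scale_majorant_def sum_distrib_left mult_ac)
qed

lemma sum_divisor_count_le: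
  assumes K: "K \<ge> 1" and A: "\<And>n. n \<in> A \<Longrightarrow> real n \<le> z powr K"
  shows "(\<Sum>n\<in>A. real (divisor_count n)) \<le> divisor_sum_const K * (Y * coprime_harmonic q z)"
proof -
  let ?YH = "Y * coprime_harmonic q z" and ?E = "rankin_const (8 * K)" and ?C = "truncation_const K"
  let ?s = "\<lambda>i. z powr (- (rankin_exponent K i / 4))"
  have main_term_nonneg: "?YH * ?E \<ge> 0" using Y_nonneg coprime_harmonic_nonneg by (simp add: rankin_const_def)
  have "(\<Sum>n\<in>A. \<Sum>i\<in>scales z. real (tau_le z n) * scale_majorant K z i n)
      = (\<Sum>i\<in>scales z. \<Sum>n\<in>A. real (tau_le z n) * scale_majorant K z i n)"
    by (rule sum.swap)
  also have "\<dots> \<le> (\<Sum>i\<in>scales z. ?s i * (?YH * ?E))"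
    using sum_tau_le_scale_majorant_le[OF K] by (rule sum_mono)
  also have "\<dots> = (\<Sum>i\<in>scales z. ?s i) * (?YH * ?E)"
    by (rule sum_distrib_right[symmetric])
  also have "\<dots> \<le> 32 * (?YH * ?E)"
    using sum_scales_powr_le[OF K, of z] z_ge_2 main_term_nonneg by (intro mult_right_mono) auto
  finally have scales_part:
    "(\<Sum>n\<in>A. \<Sum>i\<in>scales z. real (tau_le z n) * scale_majorant K z i n) \<le> 32 * (?YH * ?E)" .
  have "(\<Sum>n\<in>A. real (divisor_count n))
      \<le> (\<Sum>n\<in>A. ?C * (real (tau_le z n) * (1 + (\<Sum>i\<in>scales z. scale_majorant K z i n))))"
    using A pos_A z_ge_2 by (intro sum_mono divisor_count_le_tau_le_majorant[OF K]) auto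
  also have "\<dots> = ?C * ((\<Sum>n\<in>A. real (tau_le z n))
      + (\<Sum>n\<in>A. \<Sum>i\<in>scales z. real (tau_le z n) * scale_majorant K z i n))"
    by (simp add: sum_distrib_left sum.distrib distrib_left)
  also have "\<dots> \<le> ?C * (?YH + 32 * (?YH * ?E))"
    using truncation_const_ge_1[OF K] sum_tau_le_short_le[of z] scales_part
    by (intro mult_left_mono add_mono) auto
  finally show ?thesis by (simp add: divisor_sum_const_def algebra_simps)
qed

lemma sum_tau_le_le:
  assumes K: "K \<ge> 1" and A: "\<And>n. n \<in> A \<Longrightarrow> real n \<le> z powr K"
  shows "(\<Sum>n\<in>A. real (tau_le N n)) \<le> divisor_sum_const K * (Y * coprime_harmonic q (min N z))"
proof (cases "N \<le> z")
  case True
  have "Y * coprime_harmonic q N \<le> divisor_sum_const K * (Y * coprime_harmonic q N)"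
    using divisor_sum_const_ge_1[OF K] Y_nonneg coprime_harmonic_nonneg[of q N]
      mult_right_mono[of 1 "divisor_sum_const K" "Y * coprime_harmonic q N"] by simp
  with True sum_tau_le_short_le[OF True] show ?thesis by (simp add: min_def)
next
  case False
  have "(\<Sum>n\<in>A. real (tau_le N n)) \<le> (\<Sum>n\<in>A. real (divisor_count n))"
    by (intro sum_mono of_nat_mono tau_le_le_divisor_count pos_A)
  with False sum_divisor_count_le[OF K A] show ?thesis by (simp add: min_def)
qed

end

section \<open>Divisor sums over arithmetic progressions\<close>

lemma level_of_distribution_progression:
  assumes "z \<ge> 2" and q: "q > 0" and r: "coprime r (int q)" and y: "z\<^sup>2 * real q \<le> y"
  shows "level_of_distribution (progression q r w (w + y)) q (2 * y / real q) z"
proof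
  have "0 \<le> z\<^sup>2 * real q" by simp
  then have y_nonneg: "y \<ge> 0" using y by (rule order_trans)
  then show "2 * y / real q \<ge> 0" by simp
  fix l :: nat assume l: "l > 0" "real l \<le> z\<^sup>2"
  have "real l * real q \<le> z\<^sup>2 * real q" using l by (intro mult_right_mono) auto
  then have ql_le_y: "real (q * l) \<le> y" using y by (simp add: mult.commute)
  then have "real (card {n \<in> progression q r w (w + y). l dvd n}) \<le> y / real (q * l) + 1"
    using q l y_nonneg r by (intro card_progression_multiples_le)
  also have "1 \<le> y / real (q * l)" using ql_le_y q l by simp
  finally show "real (card {n \<in> progression q r w (w + y). l dvd n}) \<le> 2 * y / real q / real l"
    by (simp add: mult.commute)
qed (use assms finite_progression coprime_progression[OF r] in \<open>auto simp: progression_def\<close>)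

lemma coprime_harmonic_le_ln:
  assumes \<kappa>: "\<kappa> > 0" and q: "q > 0" "real q powr \<kappa> \<le> N" and "N \<ge> 2" "1 \<le> t" "t \<le> N"
  shows "coprime_harmonic q t \<le> 2 * (3 + 1 / \<kappa>) * (real (totient q) / real q * ln N)"
proof -
  have ln_N: "2 / 3 \<le> ln N" using ln2_ge_two_thirds assms by (auto intro: order_trans)
  have "\<kappa> * ln (real q) \<le> ln N"
    using ln_mono[OF q(2)] q by (simp add: ln_powr)
  then have "ln (real q) \<le> 1 / \<kappa> * ln N" using \<kappa> by (simp add: field_simps)
  moreover have "ln (t * real q) \<le> ln N + ln (real q)" using assms by (simp add: ln_mult)
  ultimately have "1 + ln (t * real q) \<le> (3 + 1 / \<kappa>) * ln N"
    using ln_N unfolding distrib_right by linarith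
  then have "2 * (real (totient q) / real q) * (1 + ln (t * real q))
      \<le> 2 * (real (totient q) / real q) * ((3 + 1 / \<kappa>) * ln N)"
    by (rule mult_left_mono) simp
  then show ?thesis using coprime_harmonic_le[OF q(1) \<open>1 \<le> t\<close>] by (simp add: mult_ac)
qed

definition progression_const :: "real \<Rightarrow> real \<Rightarrow> real" where
  "progression_const K \<kappa> = 4 * divisor_sum_const K * (3 + 1 / \<kappa>)"

lemma progression_const_pos:
  assumes "K \<ge> 1" "\<kappa> > 0"
  shows "progression_const K \<kappa> > 0"
  using divisor_sum_const_ge_1[OF assms(1)] assms(2)
  by (simp add: progression_const_def add_pos_pos)

lemma sum_tau_le_progression_le:
  assumes K: "K \<ge> 1" and \<kappa>: "\<kappa> > 0" and z: "z \<ge> 2" and N: "N \<ge> 2"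
    and q: "q > 0" "real q powr \<kappa> \<le> N" and r: "coprime r (int q)"
    and y: "z\<^sup>2 * real q \<le> y" "w + y \<le> z powr K"
  shows "(\<Sum>n\<in>progression q r w (w + y). real (tau_le N n))
           \<le> progression_const K \<kappa> * (y * real (totient q) * ln N / (real q)\<^sup>2)"
proof -
  interpret level_of_distribution "progression q r w (w + y)" q "2 * y / real q" z
    using z q(1) r y(1) by (rule level_of_distribution_progression)
  have "(\<Sum>n\<in>progression q r w (w + y). real (tau_le N n))
      \<le> divisor_sum_const K * (2 * y / real q * coprime_harmonic q (min N z))"
    using y(2) by (intro sum_tau_le_le[OF K]) (auto simp: progression_def)
  also have "\<dots> \<le> divisor_sum_const K * (2 * y / real q *
      (2 * (3 + 1 / \<kappa>) * (real (totient q) / real q * ln N)))"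
    using divisor_sum_const_ge_1[OF K] Y_nonneg z N
    by (intro mult_left_mono coprime_harmonic_le_ln[OF \<kappa> q]) auto
  finally show ?thesis
    by (simp add: progression_const_def power2_eq_square mult_ac)
qed

lemma short_interval_level:
  assumes \<delta>: "\<delta> > 0" and \<eta>: "0 < \<eta>" "\<eta> \<le> 1" and q: "q > 0"
    and x: "2 powr (2 / \<eta>) * real q powr (1 + \<delta>) \<le> x"
    and y: "x powr (1 / (1 + \<delta>) + \<eta>) \<le> y" "y \<le> x"
  defines "z \<equiv> x powr (\<eta> / 2)"
  shows "z \<ge> 2" "z\<^sup>2 * real q \<le> y" "x + y \<le> z powr (4 / \<eta>)"
proof -
  have q_powr_ge_1: "real q powr (1 + \<delta>) \<ge> 1" using q \<delta> by (intro ge_one_powr_ge_zero) auto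
  have threshold_ge_2: "2 powr (2 / \<eta>) \<ge> 2"
    using powr_mono[of 1 "2 / \<eta>" 2] \<eta> by (simp add: field_simps)
  have "2 powr (2 / \<eta>) * 1 \<le> 2 powr (2 / \<eta>) * real q powr (1 + \<delta>)"
    using q_powr_ge_1 by (rule mult_left_mono) simp
  then have x_lower: "2 powr (2 / \<eta>) \<le> x" "2 \<le> x" using x threshold_ge_2 by linarith+
  have "(2 powr (2 / \<eta>)) powr (\<eta> / 2) \<le> z"
    unfolding z_def using x_lower \<eta> by (intro powr_mono2) auto
  then show "z \<ge> 2" using \<eta> by (simp add: powr_powr)
  have "1 * real q powr (1 + \<delta>) \<le> 2 powr (2 / \<eta>) * real q powr (1 + \<delta>)"
    using threshold_ge_2 by (intro mult_right_mono) auto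
  then have "(real q powr (1 + \<delta>)) powr (1 / (1 + \<delta>)) \<le> x powr (1 / (1 + \<delta>))"
    using x \<delta> by (intro powr_mono2) auto
  then have "real q \<le> x powr (1 / (1 + \<delta>))" using q \<delta> by (simp add: powr_powr)
  then have "z\<^sup>2 * real q \<le> x powr \<eta> * x powr (1 / (1 + \<delta>))"
    unfolding z_def by (intro mult_mono) (simp_all add: power2_eq_square flip: powr_add)
  also have "\<dots> \<le> y" using y(1) by (simp add: add.commute flip: powr_add)
  finally show "z\<^sup>2 * real q \<le> y" .
  have "x + y \<le> 2 * x" using y(2) by simp
  also have "\<dots> \<le> x * x" using x_lower by (intro mult_right_mono) auto
  also have "\<dots> = z powr (4 / \<eta>)"
    using \<eta> x_lower by (simp add: z_def powr_powr powr_numeral power2_eq_square)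
  finally show "x + y \<le> z powr (4 / \<eta>)" .
qed

theorem theorem1p7:
  fixes \<delta> \<epsilon> \<kappa> :: real
  assumes "0 < \<delta>" and "\<delta> \<le> 1" and "0 < \<epsilon>" and "\<epsilon> < 1 / 8" and "0 < \<kappa>"
  shows "\<exists>c0 C :: real. c0 > 0 \<and> C > 0 \<and>
    (\<forall>(N :: real) (q :: nat) (r :: int) (x :: real) (y :: real).
       N \<ge> 2 \<and> q > 0 \<and> N \<ge> real q powr \<kappa> \<and> coprime r (int q) \<and>
       x powr ((1 + 4 * \<epsilon> * \<delta>) / (1 + \<delta>)) \<le> y \<and> y \<le> x \<and>
       x \<ge> c0 * real q powr (1 + \<delta>) \<longrightarrow>
         (\<Sum>n | n > 0 \<and> x < real n \<and> real n \<le> x + y \<and> [int n = r] (mod int q). real (tau_le N n))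
           \<le> C * (y * real (totient q) * ln N / (real q)\<^sup>2)
       \<and> (\<Sum>m | m > 0 \<and> real m \<le> x \<and> [int m = r] (mod int q). real (tau_le N m))
           \<le> C * (real (totient q) * x * ln N / (real q)\<^sup>2))"
proof -
  define \<eta> where "\<eta> = 4 * \<epsilon> * \<delta> / (1 + \<delta>)"
  have "4 * \<epsilon> * \<delta> \<le> 1 * (1 + \<delta>)" using assms by (intro mult_mono) auto
  then have \<eta>: "0 < \<eta>" "\<eta> \<le> 1" using assms by (auto simp: \<eta>_def)
  have exponent: "(1 + 4 * \<epsilon> * \<delta>) / (1 + \<delta>) = 1 / (1 + \<delta>) + \<eta>"
    by (simp add: \<eta>_def add_divide_distrib)
  have K: "4 / \<eta> \<ge> 1" using \<eta> by simp
  show ?thesis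
  proof (intro exI conjI allI impI; (elim conjE)?)
    fix N x y :: real and q :: nat and r :: int
    assume N: "N \<ge> 2" and q: "q > 0" "N \<ge> real q powr \<kappa>" and r: "coprime r (int q)"
      and x: "2 powr (2 / \<eta>) * real q powr (1 + \<delta>) \<le> x"
      and y: "x powr ((1 + 4 * \<epsilon> * \<delta>) / (1 + \<delta>)) \<le> y" "y \<le> x"
    note level = short_interval_level[OF assms(1) \<eta> q(1) x y[unfolded exponent]]
    note bound = sum_tau_le_progression_le[OF K assms(5) level(1) N q r]
    show "(\<Sum>n | n > 0 \<and> x < real n \<and> real n \<le> x + y \<and> [int n = r] (mod int q). real (tau_le N n))
        \<le> progression_const (4 / \<eta>) \<kappa> * (y * real (totient q) * ln N / (real q)\<^sup>2)"
      using bound[OF level(2,3)] by (simp add: progression_def)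
    have "y \<ge> 0" using y(1) by (rule order_trans[rotated]) simp
    then show "(\<Sum>m | m > 0 \<and> real m \<le> x \<and> [int m = r] (mod int q). real (tau_le N m))
        \<le> progression_const (4 / \<eta>) \<kappa> * (real (totient q) * x * ln N / (real q)\<^sup>2)"
      using bound[of x 0] level(2,3) y(2) by (simp add: progression_def mult_ac)
  qed (use progression_const_pos[OF K assms(5)] in simp_all)
qed

end
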